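(* Let $\mathbb{T}$ be a time scale, let $a,b\in\mathbb{T}$ with $a<b$, let $f,g:[a,b]_{\mathbb{T}}\to\mathbb{R}_{\mathcal{I}}$ be $IR$ $\Delta$-integrable on $[a,b]_{\mathbb{T}}$, and let $\lambda$ be an arbitrary real number. Then: (1) $\lambda f$ is $IR$ $\Delta$-integrable on $[a,b]_{\mathbb{T}}$ and $(IR)\int_a^b\lambda f(t)\Delta t=\lambda\,(IR)\int_a^b f(t)\Delta t$; (2) $f+g$ is $IR$ $\Delta$-integrable on $[a,b]_{\mathbb{T}}$ and $(IR)\int_a^b(f(t)+g(t))\Delta t=(IR)\int_a^b f(t)\Delta t+(IR)\int_a^b g(t)\Delta t$; (3) for $c\in[a,b]_{\mathbb{T}}$ with $a<c<b$, $(IR)\int_a^c f(t)\Delta t+(IR)\int_c^b f(t)\Delta t=(IR)\int_a^b f(t)\Delta t$; (4) if $f(t)\subseteq g(t)$ for all $t\in[a,b]_{\mathbb{T}}$, then $(IR)\int_a^b f(t)\Delta t\subseteq(IR)\int_a^b g(t)\Delta t$.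
   Context: A time scale $\mathbb{T}$ is a nonempty closed subset of $\mathbb{R}$. For $a,b\in\mathbb{T}$, $[a,b]_{\mathbb{T}}=\{t\in\mathbb{T}:a\le t\le b\}$ and $[a,b)_{\mathbb{T}}=\{t\in\mathbb{T}:a\le t<b\}$. The backward jump operator is $\rho(t)=\sup\{s\in\mathbb{T}:s<t\}$. $\mathbb{R}_{\mathcal{I}}$ is the set of nonempty compact intervals $[\underline{u},\overline{u}]\subset\mathbb{R}$, $\underline{u}\le\overline{u}$ (degenerate intervals allowed), with metric $d([\underline{u},\overline{u}],[\underline{v},\overline{v}])=\max\{|\underline{u}-\underline{v}|,|\overline{u}-\overline{v}|\}$. Interval operations: $[\underline{u},\overline{u}]+[\underline{v},\overline{v}]=[\underline{u}+\underline{v},\overline{u}+\overline{v}]$; $\lambda[\underline{u},\overline{u}]$ equals $[\lambda\underline{u},\lambda\overline{u}]$ if $\lambda>0$, $\{0\}$ if $\lambda=0$, $[\lambda\overline{u},\lambda\underline{u}]$ if $\lambda<0$. Operations on interval-valued functions are pointwise. A division of $[a,b]_{\mathbb{T}}$ is a finite set $D=\{a=t_0<t_1<\cdots<t_n=b\}\subseteq[a,b]_{\mathbb{T}}$. For $\delta>0$, $\mathcal{D}(\delta,[a,b]_{\mathbb{T}})$ is the (nonempty) set of divisions such that for each $i$ either $t_i-t_{i-1}\le\delta$, or $t_i-t_{i-1}>\delta$ and $\rho(t_i)=t_{i-1}$. A Riemann $\Delta$-sum of $f$ corresponding to $D\in\mathcal{D}(\delta,[a,b]_{\mathbb{T}})$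 is $S(f,D,\delta)=\sum_{i=1}^n f(\xi_i)(t_i-t_{i-1})$ with arbitrary $\xi_i\in[t_{i-1},t_i)_{\mathbb{T}}$. A function $f:[a,b]_{\mathbb{T}}\to\mathbb{R}_{\mathcal{I}}$ is $IR$ $\Delta$-integrable with integral $A=(IR)\int_a^b f(t)\Delta t\in\mathbb{R}_{\mathcal{I}}$ if for every $\epsilon>0$ there is $\delta>0$ such that $d(S(f,D,\delta),A)<\epsilon$ for all $D\in\mathcal{D}(\delta,[a,b]_{\mathbb{T}})$ and all choices of the $\xi_i$. *)

theory Defs
  imports "HOL-Analysis.Analysis" "HOL-Library.Interval"
begin

text \<open>
  Compact real intervals are the library type \<open>real interval\<close> (nonempty, degenerate intervals
  allowed), with its endpointwise addition and zero. The library type carries neither a scalar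
  multiplication by reals nor a metric.
\<close>

lemma lower_Interval: "l \<le> u \<Longrightarrow> lower (Interval (l, u)) = l"
  and upper_Interval: "l \<le> u \<Longrightarrow> upper (Interval (l, u)) = u"
  for l u :: real
  by (simp_all add: lower.rep_eq upper.rep_eq Interval_inverse)

definition interval_scale :: "real \<Rightarrow> real interval \<Rightarrow> real interval" (infixr \<open>*\<^sub>I\<close> 75) where
  "c *\<^sub>I u =
     (if c > 0 then Interval (c * lower u, c * upper u)
      else if c = 0 then Interval (0, 0)
      else Interval (c * upper u, c * lower u))"

lemma lower_interval_scale:
  "lower (c *\<^sub>I u) = (if c > 0 then c * lower u else if c = 0 then 0 else c * upper u)"
  by (auto simp: interval_scale_def lower_Interval mult_left_mono mult_left_mono_neg)

lemma upper_interval_scale: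
  "upper (c *\<^sub>I u) = (if c > 0 then c * upper u else if c = 0 then 0 else c * lower u)"
  by (auto simp: interval_scale_def upper_Interval mult_left_mono mult_left_mono_neg)

definition interval_dist :: "real interval \<Rightarrow> real interval \<Rightarrow> real" where
  "interval_dist u v = max \<bar>lower u - lower v\<bar> \<bar>upper u - upper v\<bar>"

definition time_scale :: "real set \<Rightarrow> bool" where
  "time_scale T \<longleftrightarrow> T \<noteq> {} \<and> closed T"

text \<open>
  The supremum is taken over a nonempty set unless \<open>t\<close> is minimal in \<open>T\<close>; below it is only
  used at right endpoints of subintervals, which are never minimal.
\<close>

definition backward_jump :: "real set \<Rightarrow> real \<Rightarrow> real" where
  "backward_jump T t = Sup {s \<in> T. s < t}"

text \<open>
  A division is given by its increasing enumeration \<open>t 0 < \<dots> < t n\<close>; the values of \<open>t\<close> beyond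
  index \<open>n\<close> are irrelevant.
\<close>

definition ts_division :: "real set \<Rightarrow> real \<Rightarrow> real \<Rightarrow> nat \<Rightarrow> (nat \<Rightarrow> real) \<Rightarrow> bool" where
  "ts_division T a b n t \<longleftrightarrow>
     t 0 = a \<and> t n = b \<and> (\<forall>i<n. t i < t (Suc i)) \<and> (\<forall>i\<le>n. t i \<in> T \<inter> {a..b})"

definition delta_division ::
  "real \<Rightarrow> real set \<Rightarrow> real \<Rightarrow> real \<Rightarrow> nat \<Rightarrow> (nat \<Rightarrow> real) \<Rightarrow> bool" where
  "delta_division \<delta> T a b n t \<longleftrightarrow>
     ts_division T a b n t \<and>
     (\<forall>i<n. t (Suc i) - t i \<le> \<delta> \<or>
            (t (Suc i) - t i > \<delta> \<and> backward_jump T (t (Suc i)) = t i))"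

definition ts_tags :: "real set \<Rightarrow> nat \<Rightarrow> (nat \<Rightarrow> real) \<Rightarrow> (nat \<Rightarrow> real) \<Rightarrow> bool" where
  "ts_tags T n t \<xi> \<longleftrightarrow> (\<forall>i<n. \<xi> i \<in> T \<inter> {t i..<t (Suc i)})"

definition delta_sum ::
  "(real \<Rightarrow> real interval) \<Rightarrow> nat \<Rightarrow> (nat \<Rightarrow> real) \<Rightarrow> (nat \<Rightarrow> real) \<Rightarrow> real interval" where
  "delta_sum f n t \<xi> = (\<Sum>i<n. (t (Suc i) - t i) *\<^sub>I f (\<xi> i))"

text \<open>
  Functions on the time scale interval are total functions on the reals; only their values on
  \<open>T \<inter> {a..b}\<close> enter the following definitions.
\<close>

definition has_IR_delta_integral ::
  "real set \<Rightarrow> (real \<Rightarrow> real interval) \<Rightarrow> real \<Rightarrow> real \<Rightarrow> real interval \<Rightarrow> bool" where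
  "has_IR_delta_integral T f a b A \<longleftrightarrow>
     (\<forall>\<epsilon>>0. \<exists>\<delta>>0. \<forall>n t \<xi>. delta_division \<delta> T a b n t \<longrightarrow> ts_tags T n t \<xi> \<longrightarrow>
        interval_dist (delta_sum f n t \<xi>) A < \<epsilon>)"

definition IR_delta_integrable ::
  "real set \<Rightarrow> (real \<Rightarrow> real interval) \<Rightarrow> real \<Rightarrow> real \<Rightarrow> bool" where
  "IR_delta_integrable T f a b \<longleftrightarrow> (\<exists>A. has_IR_delta_integral T f a b A)"

definition IR_delta_integral ::
  "real set \<Rightarrow> (real \<Rightarrow> real interval) \<Rightarrow> real \<Rightarrow> real \<Rightarrow> real interval" where
  "IR_delta_integral T f a b = (THE A. has_IR_delta_integral T f a b A)"

end

theory Submission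
  imports Defs
begin

text \<open>
  The proof rests on two reductions. First, an interval sum is computed endpoint by endpoint,
  and \<open>interval_dist\<close> is the maximum of the endpoint distances; so an interval-valued function
  is integrable exactly when the Riemann \<open>\<Delta>\<close>-sums of its lower and upper endpoint functions
  both converge. (A negative scalar swaps the two endpoints, which is harmless.)

  Secondly, ``for all sufficiently fine divisions and all tags'' is the notion of ``eventually''
  of a filter on tagged divisions, \<open>fine_divisions\<close>. The real integral becomes an ordinary limit
  along this filter, so linearity and monotonicity are instances of the limit laws. Uniqueness
  of limits and comparison of limits require the filter to be proper, that is, arbitrarily fine
  divisions must exist (\<open>tagged_divisions_nonempty\<close>). This is where the closedness of the
  time scale enters.

  Additivity over \<open>a < c < b\<close> comes from juxtaposing divisions. Juxtaposition preserves
  fineness, because the gap condition only refers to the whole time scale, and it adds the sums.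
  Completing two fine divisions of \<open>[a, c]\<close> by one and the same division of \<open>[c, b]\<close> shows that
  the sums over \<open>[a, c]\<close> are Cauchy, hence convergent (\<open>delta_sums_converge_left\<close>); the right
  half is symmetric. Once all limits exist, the sum of the limits over the halves and the limit
  over \<open>[a, b]\<close> are limits of the same function along the product of the two filters
  (\<open>delta_limit_additive\<close>).
\<close>

section \<open>Tagged divisions and their existence\<close>

type_synonym tagged_division = "nat \<times> (nat \<Rightarrow> real) \<times> (nat \<Rightarrow> real)"

definition tagged_divisions :: "real \<Rightarrow> real set \<Rightarrow> real \<Rightarrow> real \<Rightarrow> tagged_division set" where
  "tagged_divisions \<delta> T a b = {(n, t, \<xi>). delta_division \<delta> T a b n t \<and> ts_tags T n t \<xi>}"

definition juxtapose :: "tagged_division \<Rightarrow> tagged_division \<Rightarrow> tagged_division" where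
  "juxtapose x y = (case x of (n, t, \<xi>) \<Rightarrow> case y of (m, s, \<eta>) \<Rightarrow>
     (n + m, \<lambda>i. if i < n then t i else s (i - n), \<lambda>i. if i < n then \<xi> i else \<eta> (i - n)))"

lemma tagged_divisions_mono:
  assumes "\<delta> \<le> \<delta>'"
  shows "tagged_divisions \<delta> T a b \<subseteq> tagged_divisions \<delta>' T a b"
  using assms unfolding tagged_divisions_def delta_division_def by fastforce

lemma tagged_divisions_le:
  assumes "x \<in> tagged_divisions \<delta> T a b"
  shows "a \<le> b"
proof -
  obtain n t \<xi> where "x = (n, t, \<xi>)"
    by (cases x)
  with assms have "t 0 = a" "t 0 \<in> {a..b}"
    unfolding tagged_divisions_def delta_division_def ts_division_def by auto
  then show ?thesis
    by simp
qed

lemma juxtapose_in_tagged_divisions: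
  assumes x: "x \<in> tagged_divisions \<delta> T a c" and y: "y \<in> tagged_divisions \<delta> T c b"
  shows "juxtapose x y \<in> tagged_divisions \<delta> T a b"
proof -
  obtain n t \<xi> where x_eq: "x = (n, t, \<xi>)"
    by (cases x)
  obtain m s \<eta> where y_eq: "y = (m, s, \<eta>)"
    by (cases y)
  define u where "u i = (if i < n then t i else s (i - n))" for i
  define \<zeta> where "\<zeta> i = (if i < n then \<xi> i else \<eta> (i - n))" for i
  have t: "t 0 = a" "t n = c" "\<And>i. i < n \<Longrightarrow> t i < t (Suc i)" "\<And>i. i \<le> n \<Longrightarrow> t i \<in> T \<inter> {a..c}"
      "\<And>i. i < n \<Longrightarrow> t (Suc i) - t i \<le> \<delta> \<or>
            (t (Suc i) - t i > \<delta> \<and> backward_jump T (t (Suc i)) = t i)"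
      "\<And>i. i < n \<Longrightarrow> \<xi> i \<in> T \<inter> {t i..<t (Suc i)}"
    using x unfolding x_eq tagged_divisions_def delta_division_def ts_division_def ts_tags_def
    by auto
  have s: "s 0 = c" "s m = b" "\<And>i. i < m \<Longrightarrow> s i < s (Suc i)" "\<And>i. i \<le> m \<Longrightarrow> s i \<in> T \<inter> {c..b}"
      "\<And>i. i < m \<Longrightarrow> s (Suc i) - s i \<le> \<delta> \<or>
            (s (Suc i) - s i > \<delta> \<and> backward_jump T (s (Suc i)) = s i)"
      "\<And>i. i < m \<Longrightarrow> \<eta> i \<in> T \<inter> {s i..<s (Suc i)}"
    using y unfolding y_eq tagged_divisions_def delta_division_def ts_division_def ts_tags_def
    by auto
  have "a \<le> c" "c \<le> b"
    using tagged_divisions_le[OF x] tagged_divisions_le[OF y] .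
  \<comment> \<open>The two enumerations agree at the seam, since both give \<open>c\<close> at index \<open>n\<close>.\<close>
  have left: "u i = t i" if "i \<le> n" for i
    using that t(2) s(1) by (cases "i = n") (auto simp: u_def)
  have right: "u (n + j) = s j" for j
    by (simp add: u_def)
  have step: "u i < u (Suc i) \<and>
      (u (Suc i) - u i \<le> \<delta> \<or> (u (Suc i) - u i > \<delta> \<and> backward_jump T (u (Suc i)) = u i)) \<and>
      \<zeta> i \<in> T \<inter> {u i..<u (Suc i)}"
    if i: "i < n + m" for i
  proof (cases "i < n")
    case True
    then have "u i = t i" "u (Suc i) = t (Suc i)" "\<zeta> i = \<xi> i"
      by (auto simp: left \<zeta>_def)
    then show ?thesis
      using t(3,5,6) True by metis
  next
    case False
    define j where "j = i - n"
    have j: "i = n + j" "j < m"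
      using False i by (auto simp: j_def)
    then have "u i = s j" "u (Suc i) = s (Suc j)" "\<zeta> i = \<eta> j"
      using right[of "Suc j"] by (auto simp: right \<zeta>_def)
    then show ?thesis
      using s(3,5,6) j by metis
  qed
  have mem: "u i \<in> T \<inter> {a..b}" if i: "i \<le> n + m" for i
  proof (cases "i \<le> n")
    case True
    then show ?thesis
      using t(4)[of i] \<open>c \<le> b\<close> by (auto simp: left)
  next
    case False
    then have "i = n + (i - n)" "i - n \<le> m"
      using i by auto
    then show ?thesis
      using s(4)[of "i - n"] right[of "i - n"] \<open>a \<le> c\<close> by auto
  qed
  have ends: "u 0 = a" "u (n + m) = b"
    using left[of 0] right[of m] t(1) s(2) by auto
  have "(n + m, u, \<zeta>) \<in> tagged_divisions \<delta> T a b"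
    using ends step mem
    unfolding tagged_divisions_def delta_division_def ts_division_def ts_tags_def by blast
  moreover have "juxtapose x y = (n + m, u, \<zeta>)"
    unfolding juxtapose_def x_eq y_eq u_def \<zeta>_def by simp
  ultimately show ?thesis
    by simp
qed

lemma tagged_divisions_single_step:
  assumes "a \<in> T" "b \<in> T" "a \<le> b" and "b - a \<le> \<delta> \<or> backward_jump T b = a"
  shows "tagged_divisions \<delta> T a b \<noteq> {}"
proof (cases "a = b")
  case True
  then have "(0, \<lambda>_. a, \<lambda>_. a) \<in> tagged_divisions \<delta> T a b"
    using assms
    by (simp add: tagged_divisions_def delta_division_def ts_division_def ts_tags_def)
  then show ?thesis
    by blast
next
  case False
  then have "(1, \<lambda>i. if i = 0 then a else b, \<lambda>_. a) \<in> tagged_divisions \<delta> T a b"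
    using assms
    by (auto simp: tagged_divisions_def delta_division_def ts_division_def ts_tags_def)
  then show ?thesis
    by blast
qed

lemma tagged_divisions_nonempty_trans:
  assumes "tagged_divisions \<delta> T a c \<noteq> {}" "tagged_divisions \<delta> T c b \<noteq> {}"
  shows "tagged_divisions \<delta> T a b \<noteq> {}"
  using assms juxtapose_in_tagged_divisions by blast

text \<open>
  A division is built from the left in strides that advance by at least \<open>\<delta>\<close>, until \<open>b\<close> is within
  \<open>\<delta>\<close>; hence the induction on a bound for the number of strides. From \<open>a\<close>, go to the last point
  \<open>s\<close> of the time scale not beyond \<open>a + \<delta>\<close>, a short step, and from there to the first point \<open>u\<close>
  not before \<open>a + \<delta>\<close>. Either \<open>s = u\<close>, or nothing lies between them and the step is a permitted
  jump. Both points exist because the time scale is closed.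
\<close>

lemma tagged_divisions_nonempty:
  assumes T: "closed T" and b: "b \<in> T" and a: "a \<in> T" and ab: "a \<le> b" and \<delta>: "\<delta> > 0"
  shows "tagged_divisions \<delta> T a b \<noteq> {}"
proof -
  have *: "tagged_divisions \<delta> T a b \<noteq> {}" if "a \<in> T" "a \<le> b" "b - a \<le> real k * \<delta>" for k a
    using that
  proof (induction k arbitrary: a)
    case 0
    then show ?case
      using b \<delta> by (intro tagged_divisions_single_step) auto
  next
    case (Suc k)
    show ?case
    proof (cases "b - a \<le> \<delta>")
      case True
      then show ?thesis
        using Suc.prems b by (intro tagged_divisions_single_step) auto
    next
      case False
      have "compact (T \<inter> {a..a + \<delta>})" "T \<inter> {a..a + \<delta>} \<noteq> {}"
        using T Suc.prems \<delta> by (auto intro!: closed_Int_compact)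
      then obtain s where s: "s \<in> T \<inter> {a..a + \<delta>}" "\<forall>x \<in> T \<inter> {a..a + \<delta>}. x \<le> s"
        using compact_attains_sup by metis
      have "compact (T \<inter> {a + \<delta>..b})" "T \<inter> {a + \<delta>..b} \<noteq> {}"
        using T b False by (auto intro!: closed_Int_compact)
      then obtain u where u: "u \<in> T \<inter> {a + \<delta>..b}" "\<forall>x \<in> T \<inter> {a + \<delta>..b}. u \<le> x"
        using compact_attains_inf by metis
      have first: "tagged_divisions \<delta> T a s \<noteq> {}"
        using Suc.prems s by (intro tagged_divisions_single_step) auto
      have second: "tagged_divisions \<delta> T s u \<noteq> {}"
      proof (cases "s = u")
        case True
        then show ?thesis
          using s \<delta> by (intro tagged_divisions_single_step) auto
      next
        case False
        then have "s < u"
          using s u by auto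
        have "x \<le> s" if "x \<in> T" "x < u" for x
        proof (rule ccontr)
          assume "\<not> x \<le> s"
          moreover from this have "a + \<delta> < x"
            using s that by (cases "x \<le> a + \<delta>") auto
          ultimately show False
            using u that by force
        qed
        then have "backward_jump T u = s"
          unfolding backward_jump_def using s \<open>s < u\<close> by (intro cSup_eq_maximum) auto
        then show ?thesis
          using s u \<open>s < u\<close> by (intro tagged_divisions_single_step) auto
      qed
      have "b - u \<le> real k * \<delta>"
        using Suc.prems u by (auto simp: algebra_simps)
      then have "tagged_divisions \<delta> T u b \<noteq> {}"
        using u by (intro Suc.IH) auto
      then show ?thesis
        by (rule tagged_divisions_nonempty_trans
            [OF tagged_divisions_nonempty_trans[OF first second]])
    qed
  qed
  obtain k where "(b - a) / \<delta> \<le> real k"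
    using real_arch_simple by blast
  then have "b - a \<le> real k * \<delta>"
    using \<delta> by (simp add: field_simps)
  then show ?thesis
    by (rule *[OF a ab])
qed

section \<open>The filter of fine divisions\<close>

definition fine_divisions :: "real set \<Rightarrow> real \<Rightarrow> real \<Rightarrow> tagged_division filter" where
  "fine_divisions T a b = (INF \<delta>\<in>{0<..}. principal (tagged_divisions \<delta> T a b))"

lemma eventually_fine_divisions:
  "eventually P (fine_divisions T a b) \<longleftrightarrow> (\<exists>\<delta>>0. \<forall>x\<in>tagged_divisions \<delta> T a b. P x)"
proof -
  have "\<exists>x\<in>{0<..}. principal (tagged_divisions x T a b)
          \<le> inf (principal (tagged_divisions \<delta> T a b)) (principal (tagged_divisions \<delta>' T a b))"
    if "\<delta> \<in> {0<..}" "\<delta>' \<in> {0<..}" for \<delta> \<delta>'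
    using that tagged_divisions_mono[of "min \<delta> \<delta>'" \<delta>] tagged_divisions_mono[of "min \<delta> \<delta>'" \<delta>']
    by (intro bexI[of _ "min \<delta> \<delta>'"]) auto
  then show ?thesis
    unfolding fine_divisions_def
    by (subst eventually_INF_base) (auto simp: eventually_principal gt_ex)
qed

lemma eventually_in_tagged_divisions:
  "\<delta> > 0 \<Longrightarrow> eventually (\<lambda>x. x \<in> tagged_divisions \<delta> T a b) (fine_divisions T a b)"
  unfolding eventually_fine_divisions by blast

lemma fine_divisions_neq_bot:
  assumes "closed T" "a \<in> T" "b \<in> T" "a \<le> b"
  shows "fine_divisions T a b \<noteq> bot"
  using tagged_divisions_nonempty[OF assms(1,3,2,4)]
  unfolding trivial_limit_def eventually_fine_divisions by blast

lemma filterlim_juxtapose: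
  "filterlim (\<lambda>(x, y). juxtapose x y) (fine_divisions T a b)
     (fine_divisions T a c \<times>\<^sub>F fine_divisions T c b)"
  unfolding filterlim_iff
proof (intro allI impI)
  fix P assume "eventually P (fine_divisions T a b)"
  then obtain \<delta> where \<delta>: "\<delta> > 0" "\<And>z. z \<in> tagged_divisions \<delta> T a b \<Longrightarrow> P z"
    unfolding eventually_fine_divisions by blast
  show "\<forall>\<^sub>F z in fine_divisions T a c \<times>\<^sub>F fine_divisions T c b. P (case z of (x, y) \<Rightarrow> juxtapose x y)"
    unfolding eventually_prod_filter
    using eventually_in_tagged_divisions[OF \<delta>(1), of T a c]
      eventually_in_tagged_divisions[OF \<delta>(1), of T c b]
      \<delta>(2)[OF juxtapose_in_tagged_divisions]
    by (intro exI conjI) auto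
qed

section \<open>Real delta-sums\<close>

definition real_delta_sum :: "(real \<Rightarrow> real) \<Rightarrow> tagged_division \<Rightarrow> real" where
  "real_delta_sum h = (\<lambda>(n, t, \<xi>). \<Sum>i<n. (t (Suc i) - t i) * h (\<xi> i))"

lemma real_delta_sum_scale:
  "real_delta_sum (\<lambda>t. c * h t) x = c * real_delta_sum h x"
  unfolding real_delta_sum_def by (auto simp: sum_distrib_left algebra_simps split: prod.split)

lemma real_delta_sum_add:
  "real_delta_sum (\<lambda>t. h t + k t) x = real_delta_sum h x + real_delta_sum k x"
  unfolding real_delta_sum_def by (auto simp: sum.distrib distrib_left split: prod.split)

lemma real_delta_sum_mono:
  assumes x: "x \<in> tagged_divisions \<delta> T a b" and le: "\<And>t. t \<in> T \<inter> {a..b} \<Longrightarrow> h t \<le> k t"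
  shows "real_delta_sum h x \<le> real_delta_sum k x"
proof -
  obtain n t \<xi> where x_eq: "x = (n, t, \<xi>)"
    by (cases x)
  have t: "\<And>i. i < n \<Longrightarrow> t i < t (Suc i)" "\<And>i. i \<le> n \<Longrightarrow> t i \<in> {a..b}"
      "\<And>i. i < n \<Longrightarrow> \<xi> i \<in> T \<inter> {t i..<t (Suc i)}"
    using x unfolding x_eq tagged_divisions_def delta_division_def ts_division_def ts_tags_def
    by auto
  have "(t (Suc i) - t i) * h (\<xi> i) \<le> (t (Suc i) - t i) * k (\<xi> i)" if "i < n" for i
    using that t(1)[of i] t(2)[of i] t(2)[of "Suc i"] t(3)[of i]
    by (intro mult_left_mono le) auto
  then show ?thesis
    unfolding real_delta_sum_def x_eq by (auto intro: sum_mono)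
qed

lemma real_delta_sum_juxtapose:
  assumes x: "x \<in> tagged_divisions \<delta> T a c" and y: "y \<in> tagged_divisions \<delta> T c b"
  shows "real_delta_sum h (juxtapose x y) = real_delta_sum h x + real_delta_sum h y"
proof -
  obtain n t \<xi> where x_eq: "x = (n, t, \<xi>)"
    by (cases x)
  obtain m s \<eta> where y_eq: "y = (m, s, \<eta>)"
    by (cases y)
  have seam: "t n = s 0"
    using x y unfolding x_eq y_eq tagged_divisions_def delta_division_def ts_division_def by auto
  define u where "u i = (if i < n then t i else s (i - n))" for i
  define \<zeta> where "\<zeta> i = (if i < n then \<xi> i else \<eta> (i - n))" for i
  define F where "F i = (u (Suc i) - u i) * h (\<zeta> i)" for i
  have split: "(\<Sum>i<n + m. F i) = (\<Sum>i<n. F i) + (\<Sum>j<m. F (n + j))"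
    by (induction m) auto
  have "F i = (t (Suc i) - t i) * h (\<xi> i)" if "i < n" for i
    using that seam by (cases "Suc i = n") (auto simp: F_def u_def \<zeta>_def)
  moreover have "F (n + j) = (s (Suc j) - s j) * h (\<eta> j)" for j
    by (simp add: F_def u_def \<zeta>_def Suc_diff_le)
  ultimately have "(\<Sum>i<n + m. F i) = real_delta_sum h x + real_delta_sum h y"
    unfolding split real_delta_sum_def x_eq y_eq by simp
  then show ?thesis
    unfolding real_delta_sum_def juxtapose_def x_eq y_eq F_def u_def \<zeta>_def by simp
qed

section \<open>Limits of real delta-sums\<close>

lemma delta_limit_mono:
  assumes F: "fine_divisions T a b \<noteq> bot"
    and h: "(real_delta_sum h \<longlongrightarrow> L) (fine_divisions T a b)"
    and k: "(real_delta_sum k \<longlongrightarrow> M) (fine_divisions T a b)"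
    and le: "\<And>t. t \<in> T \<inter> {a..b} \<Longrightarrow> h t \<le> k t"
  shows "L \<le> M"
  using F k h
proof (rule tendsto_le)
  show "\<forall>\<^sub>F x in fine_divisions T a b. real_delta_sum h x \<le> real_delta_sum k x"
    using eventually_in_tagged_divisions[of 1 T a b]
    by (rule eventually_mono[OF _ real_delta_sum_mono]) (auto intro: le)
qed

lemma delta_sums_convergeI:
  assumes F: "fine_divisions T a b \<noteq> bot"
    and Cauchy: "\<And>\<epsilon>. \<epsilon> > 0 \<Longrightarrow> \<exists>\<delta>>0. \<forall>x\<in>tagged_divisions \<delta> T a b. \<forall>y\<in>tagged_divisions \<delta> T a b.
      \<bar>real_delta_sum h x - real_delta_sum h y\<bar> < \<epsilon>"
  shows "\<exists>L. (real_delta_sum h \<longlongrightarrow> L) (fine_divisions T a b)"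
proof -
  have "\<exists>P. eventually P (fine_divisions T a b) \<and>
      (\<forall>x y. P x \<and> P y \<longrightarrow> dist (real_delta_sum h x) (real_delta_sum h y) < \<epsilon>)"
    if "\<epsilon> > 0" for \<epsilon>
    using Cauchy[OF that] eventually_in_tagged_divisions unfolding dist_real_def by meson
  then have "cauchy_filter (filtermap (real_delta_sum h) (fine_divisions T a b))"
    unfolding cauchy_filter_metric_filtermap by blast
  then show ?thesis
    unfolding filterlim_def
    using F by (intro cauchy_filter_complete_converges[OF _ complete_UNIV])
      (auto simp: filtermap_bot_iff)
qed

lemma delta_sums_close:
  assumes "(real_delta_sum h \<longlongrightarrow> L) (fine_divisions T a b)" and "\<epsilon> > 0"
  shows "\<exists>\<delta>>0. \<forall>x\<in>tagged_divisions \<delta> T a b. \<forall>y\<in>tagged_divisions \<delta> T a b.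
      \<bar>real_delta_sum h x - real_delta_sum h y\<bar> < \<epsilon>"
proof -
  have "\<forall>\<^sub>F x in fine_divisions T a b. dist (real_delta_sum h x) L < \<epsilon> / 2"
    using assms by (intro tendstoD) auto
  then obtain \<delta> where "\<delta> > 0" "\<forall>x\<in>tagged_divisions \<delta> T a b. \<bar>real_delta_sum h x - L\<bar> < \<epsilon> / 2"
    unfolding eventually_fine_divisions dist_real_def by blast
  moreover from this have "\<forall>x\<in>tagged_divisions \<delta> T a b. \<forall>y\<in>tagged_divisions \<delta> T a b.
      \<bar>real_delta_sum h x - real_delta_sum h y\<bar> < \<epsilon>"
    by (smt (verit) field_sum_of_halves)
  ultimately show ?thesis
    by blast
qed

text \<open>
  If divisions \<open>x\<close> and \<open>y\<close> of \<open>[a, c]\<close> are completed by the same division \<open>z\<close> of \<open>[c, b]\<close>,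
  the contribution of \<open>z\<close> cancels in the difference of the sums, which is therefore as
  small as the Cauchy property over \<open>[a, b]\<close> makes it.
\<close>

lemma delta_sums_converge_left:
  assumes T: "closed T" and mem: "a \<in> T" "b \<in> T" "c \<in> T" and le: "a \<le> c" "c \<le> b"
    and h: "(real_delta_sum h \<longlongrightarrow> L) (fine_divisions T a b)"
  shows "\<exists>M. (real_delta_sum h \<longlongrightarrow> M) (fine_divisions T a c)"
proof (rule delta_sums_convergeI)
  show "fine_divisions T a c \<noteq> bot"
    using T mem le by (intro fine_divisions_neq_bot)
  fix \<epsilon> :: real assume "\<epsilon> > 0"
  from delta_sums_close[OF h this] obtain \<delta> where \<delta>: "\<delta> > 0"
    "\<And>x y. x \<in> tagged_divisions \<delta> T a b \<Longrightarrow> y \<in> tagged_divisions \<delta> T a b \<Longrightarrow>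
      \<bar>real_delta_sum h x - real_delta_sum h y\<bar> < \<epsilon>"
    by blast
  obtain z where z: "z \<in> tagged_divisions \<delta> T c b"
    using tagged_divisions_nonempty[OF T mem(2,3) le(2) \<delta>(1)] by blast
  have "\<bar>real_delta_sum h x - real_delta_sum h y\<bar> < \<epsilon>"
    if "x \<in> tagged_divisions \<delta> T a c" "y \<in> tagged_divisions \<delta> T a c" for x y
    using \<delta>(2)[OF juxtapose_in_tagged_divisions[OF that(1) z]
        juxtapose_in_tagged_divisions[OF that(2) z]]
    by (simp add: real_delta_sum_juxtapose[OF that(1) z] real_delta_sum_juxtapose[OF that(2) z])
  with \<delta>(1) show "\<exists>\<delta>>0. \<forall>x\<in>tagged_divisions \<delta> T a c. \<forall>y\<in>tagged_divisions \<delta> T a c.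
      \<bar>real_delta_sum h x - real_delta_sum h y\<bar> < \<epsilon>"
    by blast
qed

lemma delta_sums_converge_right:
  assumes T: "closed T" and mem: "a \<in> T" "b \<in> T" "c \<in> T" and le: "a \<le> c" "c \<le> b"
    and h: "(real_delta_sum h \<longlongrightarrow> L) (fine_divisions T a b)"
  shows "\<exists>M. (real_delta_sum h \<longlongrightarrow> M) (fine_divisions T c b)"
proof (rule delta_sums_convergeI)
  show "fine_divisions T c b \<noteq> bot"
    using T mem le by (intro fine_divisions_neq_bot)
  fix \<epsilon> :: real assume "\<epsilon> > 0"
  from delta_sums_close[OF h this] obtain \<delta> where \<delta>: "\<delta> > 0"
    "\<And>x y. x \<in> tagged_divisions \<delta> T a b \<Longrightarrow> y \<in> tagged_divisions \<delta> T a b \<Longrightarrow>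
      \<bar>real_delta_sum h x - real_delta_sum h y\<bar> < \<epsilon>"
    by blast
  obtain z where z: "z \<in> tagged_divisions \<delta> T a c"
    using tagged_divisions_nonempty[OF T mem(3,1) le(1) \<delta>(1)] by blast
  have "\<bar>real_delta_sum h x - real_delta_sum h y\<bar> < \<epsilon>"
    if "x \<in> tagged_divisions \<delta> T c b" "y \<in> tagged_divisions \<delta> T c b" for x y
    using \<delta>(2)[OF juxtapose_in_tagged_divisions[OF z that(1)]
        juxtapose_in_tagged_divisions[OF z that(2)]]
    by (simp add: real_delta_sum_juxtapose[OF z that(1)] real_delta_sum_juxtapose[OF z that(2)])
  with \<delta>(1) show "\<exists>\<delta>>0. \<forall>x\<in>tagged_divisions \<delta> T c b. \<forall>y\<in>tagged_divisions \<delta> T c b.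
      \<bar>real_delta_sum h x - real_delta_sum h y\<bar> < \<epsilon>"
    by blast
qed

lemma delta_limit_additive:
  assumes F: "fine_divisions T a c \<noteq> bot" "fine_divisions T c b \<noteq> bot"
    and L: "(real_delta_sum h \<longlongrightarrow> L) (fine_divisions T a c)"
    and M: "(real_delta_sum h \<longlongrightarrow> M) (fine_divisions T c b)"
    and N: "(real_delta_sum h \<longlongrightarrow> N) (fine_divisions T a b)"
  shows "L + M = N"
proof -
  let ?G = "fine_divisions T a c \<times>\<^sub>F fine_divisions T c b"
  have "((\<lambda>z. real_delta_sum h (fst z) + real_delta_sum h (snd z)) \<longlongrightarrow> L + M) ?G"
    using filterlim_compose[OF L filterlim_fst] filterlim_compose[OF M filterlim_snd]
    by (rule tendsto_add)
  moreover have "\<forall>\<^sub>F z in ?G. real_delta_sum h (case z of (x, y) \<Rightarrow> juxtapose x y)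
      = real_delta_sum h (fst z) + real_delta_sum h (snd z)"
    unfolding eventually_prod_filter
    using eventually_in_tagged_divisions[of 1 T a c] eventually_in_tagged_divisions[of 1 T c b]
    by (intro exI conjI) (auto simp: real_delta_sum_juxtapose)
  ultimately have
    "((\<lambda>z. real_delta_sum h (case z of (x, y) \<Rightarrow> juxtapose x y)) \<longlongrightarrow> L + M) ?G"
    by (simp add: tendsto_cong)
  moreover have "((\<lambda>z. real_delta_sum h (case z of (x, y) \<Rightarrow> juxtapose x y)) \<longlongrightarrow> N) ?G"
    using N filterlim_juxtapose by (rule filterlim_compose)
  moreover have "?G \<noteq> bot"
    using F by (simp add: prod_filter_eq_bot)
  ultimately show ?thesis
    using tendsto_unique by blast
qed

section \<open>Reduction of the interval integral to its endpoints\<close>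

lemma lower_sum: "lower (sum F A) = (\<Sum>i\<in>A. lower (F i))"
  and upper_sum: "upper (sum F A) = (\<Sum>i\<in>A. upper (F i))"
  for F :: "'i \<Rightarrow> real interval"
  by (induction A rule: infinite_finite_induct) auto

lemma delta_sum_endpoints:
  assumes "(n, t, \<xi>) \<in> tagged_divisions \<delta> T a b"
  shows "lower (delta_sum f n t \<xi>) = real_delta_sum (\<lambda>s. lower (f s)) (n, t, \<xi>)"
    and "upper (delta_sum f n t \<xi>) = real_delta_sum (\<lambda>s. upper (f s)) (n, t, \<xi>)"
proof -
  have "t i < t (Suc i)" if "i < n" for i
    using assms that unfolding tagged_divisions_def delta_division_def ts_division_def by auto
  then show "lower (delta_sum f n t \<xi>) = real_delta_sum (\<lambda>s. lower (f s)) (n, t, \<xi>)"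
    and "upper (delta_sum f n t \<xi>) = real_delta_sum (\<lambda>s. upper (f s)) (n, t, \<xi>)"
    unfolding delta_sum_def real_delta_sum_def
    by (auto simp: lower_sum upper_sum lower_interval_scale upper_interval_scale intro!: sum.cong)
qed

lemma has_IR_delta_integral_iff:
  "has_IR_delta_integral T f a b A \<longleftrightarrow>
     (real_delta_sum (\<lambda>s. lower (f s)) \<longlongrightarrow> lower A) (fine_divisions T a b) \<and>
     (real_delta_sum (\<lambda>s. upper (f s)) \<longlongrightarrow> upper A) (fine_divisions T a b)"
proof -
  have "has_IR_delta_integral T f a b A \<longleftrightarrow>
    (\<forall>\<epsilon>>0. \<exists>\<delta>>0. \<forall>(n, t, \<xi>)\<in>tagged_divisions \<delta> T a b. interval_dist (delta_sum f n t \<xi>) A < \<epsilon>)"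
    unfolding has_IR_delta_integral_def tagged_divisions_def by (simp add: imp_conjL)
  also have "\<dots> \<longleftrightarrow> (\<forall>\<epsilon>>0. \<exists>\<delta>>0. \<forall>x\<in>tagged_divisions \<delta> T a b.
      dist (real_delta_sum (\<lambda>s. lower (f s)) x) (lower A) < \<epsilon> \<and>
      dist (real_delta_sum (\<lambda>s. upper (f s)) x) (upper A) < \<epsilon>)"
    by (intro all_cong ex_cong conj_cong ball_cong refl)
      (auto simp: interval_dist_def dist_real_def delta_sum_endpoints)
  also have "\<dots> \<longleftrightarrow> (\<forall>\<epsilon>>0. \<forall>\<^sub>F x in fine_divisions T a b.
      dist (real_delta_sum (\<lambda>s. lower (f s)) x) (lower A) < \<epsilon> \<and>
      dist (real_delta_sum (\<lambda>s. upper (f s)) x) (upper A) < \<epsilon>)"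
    unfolding eventually_fine_divisions ..
  finally show ?thesis
    unfolding tendsto_iff eventually_conj_iff by blast
qed

lemma IR_delta_integral_eqI:
  assumes F: "fine_divisions T a b \<noteq> bot" and A: "has_IR_delta_integral T f a b A"
  shows "IR_delta_integral T f a b = A"
  unfolding IR_delta_integral_def
proof (rule the_equality[where P = "has_IR_delta_integral T f a b", OF A])
  fix B assume "has_IR_delta_integral T f a b B"
  with A show "B = A"
    unfolding has_IR_delta_integral_iff by (blast intro: interval_eqI tendsto_unique[OF F])
qed

text \<open>
  Convergence of the endpoint sums suffices: the limits are again in the right order, so they
  bound an interval.
\<close>

lemma IR_delta_integrableI:
  assumes F: "fine_divisions T a b \<noteq> bot"
    and L: "(real_delta_sum (\<lambda>s. lower (f s)) \<longlongrightarrow> L) (fine_divisions T a b)"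
    and M: "(real_delta_sum (\<lambda>s. upper (f s)) \<longlongrightarrow> M) (fine_divisions T a b)"
  shows "IR_delta_integrable T f a b"
proof -
  have "L \<le> M"
    using F L M by (rule delta_limit_mono) simp
  then have "has_IR_delta_integral T f a b (Interval (L, M))"
    using L M by (simp add: has_IR_delta_integral_iff lower_Interval upper_Interval)
  then show ?thesis
    unfolding IR_delta_integrable_def ..
qed

lemma has_IR_delta_integral_scale:
  assumes "has_IR_delta_integral T f a b A"
  shows "has_IR_delta_integral T (\<lambda>t. r *\<^sub>I f t) a b (r *\<^sub>I A)"
proof -
  have L: "(real_delta_sum (\<lambda>s. r * lower (f s)) \<longlongrightarrow> r * lower A) (fine_divisions T a b)"
    and U: "(real_delta_sum (\<lambda>s. r * upper (f s)) \<longlongrightarrow> r * upper A) (fine_divisions T a b)"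
    using assms unfolding has_IR_delta_integral_iff real_delta_sum_scale
    by (auto intro: tendsto_mult_left)
  consider "r > 0" | "r = 0" | "r < 0"
    by linarith
  then show ?thesis
    using L U by cases
      (simp_all add: has_IR_delta_integral_iff lower_interval_scale upper_interval_scale)
qed

lemma has_IR_delta_integral_add:
  assumes "has_IR_delta_integral T f a b A" "has_IR_delta_integral T g a b B"
  shows "has_IR_delta_integral T (\<lambda>t. f t + g t) a b (A + B)"
  using assms unfolding has_IR_delta_integral_iff lower_plus upper_plus real_delta_sum_add
  by (blast intro: tendsto_add)

lemma IR_delta_integral_subset:
  assumes F: "fine_divisions T a b \<noteq> bot"
    and f: "has_IR_delta_integral T f a b A" and g: "has_IR_delta_integral T g a b B"
    and sub: "\<And>t. t \<in> T \<inter> {a..b} \<Longrightarrow> set_of (f t) \<subseteq> set_of (g t)"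
  shows "set_of A \<subseteq> set_of B"
proof -
  have le: "lower (g t) \<le> lower (f t)" "upper (f t) \<le> upper (g t)" if "t \<in> T \<inter> {a..b}" for t
    using sub[OF that] by (auto simp: set_of_eq)
  have "lower B \<le> lower A"
    using f g le(1) unfolding has_IR_delta_integral_iff by (blast intro: delta_limit_mono[OF F])
  moreover have "upper A \<le> upper B"
    using f g le(2) unfolding has_IR_delta_integral_iff by (blast intro: delta_limit_mono[OF F])
  ultimately show ?thesis
    by (auto simp: set_of_eq)
qed

section \<open>Basic properties of the interval delta-integral\<close>

theorem theorem4:
  fixes T :: "real set" and a b r :: real and f g :: "real \<Rightarrow> real interval"
  assumes "time_scale T" and "a \<in> T" and "b \<in> T" and "a < b"
    and "IR_delta_integrable T f a b" and "IR_delta_integrable T g a b"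
  shows
    "(IR_delta_integrable T (\<lambda>t. r *\<^sub>I f t) a b \<and>
      IR_delta_integral T (\<lambda>t. r *\<^sub>I f t) a b = r *\<^sub>I IR_delta_integral T f a b) \<and>
     (IR_delta_integrable T (\<lambda>t. f t + g t) a b \<and>
      IR_delta_integral T (\<lambda>t. f t + g t) a b
        = IR_delta_integral T f a b + IR_delta_integral T g a b) \<and>
     (\<forall>c\<in>T. a < c \<and> c < b \<longrightarrow>
        IR_delta_integrable T f a c \<and> IR_delta_integrable T f c b \<and>
        IR_delta_integral T f a c + IR_delta_integral T f c b = IR_delta_integral T f a b) \<and>
     ((\<forall>t\<in>T \<inter> {a..b}. set_of (f t) \<subseteq> set_of (g t)) \<longrightarrow>
        set_of (IR_delta_integral T f a b) \<subseteq> set_of (IR_delta_integral T g a b))"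
proof -
  have T: "closed T"
    using assms(1) unfolding time_scale_def by simp
  have proper: "fine_divisions T x y \<noteq> bot" if "x \<in> T" "y \<in> T" "x < y" for x y
    using T that by (intro fine_divisions_neq_bot) auto
  note F = proper[OF assms(2,3,4)]
  obtain A where A: "has_IR_delta_integral T f a b A"
    using assms(5) unfolding IR_delta_integrable_def ..
  obtain B where B: "has_IR_delta_integral T g a b B"
    using assms(6) unfolding IR_delta_integrable_def ..
  have eq: "IR_delta_integral T f a b = A" "IR_delta_integral T g a b = B"
    using IR_delta_integral_eqI[OF F A] IR_delta_integral_eqI[OF F B] .
  have scale: "IR_delta_integrable T (\<lambda>t. r *\<^sub>I f t) a b \<and>
      IR_delta_integral T (\<lambda>t. r *\<^sub>I f t) a b = r *\<^sub>I A"
    using has_IR_delta_integral_scale[OF A] IR_delta_integral_eqI[OF F]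
    unfolding IR_delta_integrable_def by blast
  have add: "IR_delta_integrable T (\<lambda>t. f t + g t) a b \<and>
      IR_delta_integral T (\<lambda>t. f t + g t) a b = A + B"
    using has_IR_delta_integral_add[OF A B] IR_delta_integral_eqI[OF F]
    unfolding IR_delta_integrable_def by blast
  have split: "IR_delta_integrable T f a c \<and> IR_delta_integrable T f c b \<and>
      IR_delta_integral T f a c + IR_delta_integral T f c b = A"
    if c: "c \<in> T" "a < c" "c < b" for c
  proof -
    note Fac = proper[OF assms(2) c(1,2)] and Fcb = proper[OF c(1) assms(3) c(3)]
    have le: "a \<le> c" "c \<le> b"
      using c by auto
    have lim: "(real_delta_sum (\<lambda>s. lower (f s)) \<longlongrightarrow> lower A) (fine_divisions T a b)"
      "(real_delta_sum (\<lambda>s. upper (f s)) \<longlongrightarrow> upper A) (fine_divisions T a b)"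
      using A unfolding has_IR_delta_integral_iff by auto
    note left = lim[THEN delta_sums_converge_left[OF T assms(2,3) c(1) le]]
    note right = lim[THEN delta_sums_converge_right[OF T assms(2,3) c(1) le]]
    have int: "IR_delta_integrable T f a c" "IR_delta_integrable T f c b"
      using left right IR_delta_integrableI[OF Fac] IR_delta_integrableI[OF Fcb] by blast+
    then obtain P Q where P: "has_IR_delta_integral T f a c P"
      and Q: "has_IR_delta_integral T f c b Q"
      unfolding IR_delta_integrable_def by blast
    have "lower P + lower Q = lower A" "upper P + upper Q = upper A"
      using P Q lim unfolding has_IR_delta_integral_iff
      by (blast intro: delta_limit_additive[OF Fac Fcb])+
    then have "P + Q = A"
      by (intro interval_eqI) auto
    then show ?thesis
      using int IR_delta_integral_eqI[OF Fac P] IR_delta_integral_eqI[OF Fcb Q] by simp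
  qed
  have "set_of A \<subseteq> set_of B" if "\<forall>t\<in>T \<inter> {a..b}. set_of (f t) \<subseteq> set_of (g t)"
    using IR_delta_integral_subset[OF F A B] that by blast
  with scale add split show ?thesis
    unfolding eq by blast
qed

end
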